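(* For a subset $\mathbb S$ of the positive integers define \[F_{\mathbb S}(q):=\sum_{\substack{\lambda\ne\emptyset\\ \mathrm{sm}(\lambda)\in\mathbb S}}\mu^*_{\mathcal P}(\lambda)q^{|\lambda|},\] the sum over nonempty integer partitions whose smallest part $\mathrm{sm}(\lambda)$ lies in $\mathbb S$. Let $\mathbb S_{r,t}:=\{n\in\mathbb Z^+:n\equiv r\pmod t\}$. Then for $|q|<1$: (1) $F_{\mathbb S_{1,2}}(q)=\sum_{n=1}^\infty(-1)^{n+1}q^{n^2}$ and \[F_{\mathbb S_{2,2}}(q)=1+\sum_{n=1}^\infty(-1)^nq^{n^2}-\sum_{m=-\infty}^{\infty}(-1)^mq^{m(3m-1)/2};\] (2) $\lim_{q\to1}F_{\mathbb S_{1,2}}(q)=\lim_{q\to1}F_{\mathbb S_{2,2}}(q)=\tfrac12$, where the limits are taken as $q$ tends to $1$ from within the unit disk.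
   Context: For a partition $\lambda$, $|\lambda|$ is the sum of its parts and $\ell(\lambda)$ the number of parts. The partition M\"obius function is $\mu_{\mathcal P}(\emptyset)=1$, $\mu_{\mathcal P}(\lambda)=0$ if $\lambda$ has a repeated part, and $\mu_{\mathcal P}(\lambda)=(-1)^{\ell(\lambda)}$ otherwise; $\mu^*_{\mathcal P}:=-\mu_{\mathcal P}$.
   Formalization: The limits as q tends to 1 are taken nontangentially (in each region |1-q| ≤ M(1-|q|), |q|<1, M ≥ 1, radial approach included); for unrestricted approach within the unit disk they fail, since F is unbounded along horocycles tangent at 1. *)

theory Defs
  imports "HOL-Analysis.Analysis" "HOL-Library.Multiset" "HOL-Number_Theory.Cong"
begin

text \<open>An integer partition is the finite multiset of its parts, so the sum of the parts is
  \<open>sum_mset\<close> and the number of parts is \<open>size\<close>.\<close>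

definition partitions :: "nat multiset set" where
  "partitions = {p. \<forall>i \<in># p. 0 < i}"

definition part_mu :: "nat multiset \<Rightarrow> int" where
  "part_mu p = (if p = {#} then 1 else if \<exists>i. count p i \<ge> 2 then 0 else (-1) ^ size p)"

definition part_mu_star :: "nat multiset \<Rightarrow> int" where
  "part_mu_star p = - part_mu p"

definition smallest_part :: "nat multiset \<Rightarrow> nat" where
  "smallest_part p = Min (set_mset p)"

definition partitions_sm :: "nat set \<Rightarrow> nat multiset set" where
  "partitions_sm S = {p \<in> partitions. p \<noteq> {#} \<and> smallest_part p \<in> S}"

definition F_term :: "complex \<Rightarrow> nat multiset \<Rightarrow> complex" where
  "F_term q p = of_int (part_mu_star p) * q ^ sum_mset p"

definition F_part :: "nat set \<Rightarrow> complex \<Rightarrow> complex" where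
  "F_part S q = (\<Sum>\<^sub>\<infinity>p\<in>partitions_sm S. F_term q p)"

definition res_class :: "nat \<Rightarrow> nat \<Rightarrow> nat set" where
  "res_class r t = {n. 0 < n \<and> [n = r] (mod t)}"

text \<open>Approach regions for nontangential limits at the boundary point 1 of the unit disk. The
  region for \<open>M = 1\<close> is the radius \<open>[0,1)\<close>; larger \<open>M\<close> give larger regions, whose union over
  all \<open>M\<close> is the open disk. The unrestricted limit along \<open>at 1 within ball 0 1\<close> does not exist
  for the functions considered: \<open>\<Sum>(-1)\<^sup>n q\<^bsup>n\<^sup>2\<^esup>\<close> over all integers \<open>n\<close> is a theta function,
  which is unbounded along horocycles tangent to the unit circle at 1.\<close>

definition stolz_region :: "real \<Rightarrow> complex set" where
  "stolz_region M = {q. cmod q < 1 \<and> cmod (1 - q) \<le> M * (1 - cmod q)}"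

end

theory Submission
  imports Defs
begin

text \<open>Writing \<open>O\<^sub>S(n)\<close> for the part of \<open>F\<^sub>S\<close> that comes from partitions with parts at most \<open>n\<close>,
  adjoining \<open>n + 1\<close> gives \<open>O\<^sub>S(n+1) = (1 - q\<^bsup>n+1\<^esup>) O\<^sub>S(n) + [n+1 \<in> S] q\<^bsup>n+1\<^esup>\<close>. With \<open>P\<^sub>n\<close> the product of
  \<open>1 - q\<^bsup>k\<^esup>\<close> and \<open>Q\<^sub>n\<close> that of \<open>1 + q\<^bsup>k\<^esup>\<close> for \<open>1 \<le> k \<le> n\<close>, it follows that the even and odd sums add up to
  \<open>1 - P\<^sub>n\<close> and that \<open>1 - 2 O\<^sub>o\<^sub>d\<^sub>d(n) = P\<^sub>n \<Sum>\<^sub>k\<^sub>\<le>\<^sub>n (-q)\<^bsup>k\<^esup> / P\<^sub>k\<close>. The last sum tends to \<open>1 / Q\<^sub>\<infinity>\<close> by Euler, so the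
  two formulas amount to Gauss' theta identity for \<open>P\<^sub>\<infinity> / Q\<^sub>\<infinity>\<close> and the pentagonal number theorem
  for \<open>P\<^sub>\<infinity>\<close>. Both are limits of finite identities in the style of Shanks, in which every summand but
  the first is \<open>O(|q|\<^bsup>n\<^esup>)\<close>.

  For the limits at 1, all series are \<open>\<Sum> (-1)\<^bsup>n\<^esup> q\<^bsup>g n\<^esup>\<close> with \<open>g\<close> quadratic. Summing by parts twice
  leaves a series of second differences, which in a Stolz region is dominated by a
  multiple of \<open>1 / n\<^sup>2\<close> and tends to 0 termwise.\<close>

subsection \<open>Finite \<open>q\<close>-products\<close>

text \<open>\<open>c = -1\<close> gives the products \<open>P\<close> and \<open>c = 1\<close> the
  products \<open>Q\<close>; keeping \<open>c\<close> free lets one estimate serve both.\<close>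

definition qprod :: "complex \<Rightarrow> complex \<Rightarrow> nat \<Rightarrow> complex" where
  "qprod c q n = (\<Prod>k=1..n. 1 + c * q ^ k)"

lemma qprod_0 [simp]: "qprod c q 0 = 1"
  by (simp add: qprod_def)

lemma qprod_Suc: "qprod c q (Suc n) = qprod c q n * (1 + c * q ^ Suc n)"
  by (simp add: qprod_def)

lemma sum_power_le:
  fixes x :: real
  assumes "0 \<le> x" "x < 1"
  shows "(\<Sum>k=1..n. x ^ k) \<le> x / (1 - x)"
proof -
  have "(\<Sum>k=1..n. x ^ k) = (\<Sum>k<n. x * x ^ k)"
    by (rule sum.reindex_bij_witness[of _ Suc "\<lambda>k. k - 1"])
       (auto simp flip: power_Suc)
  also have "\<dots> = x * ((1 - x ^ n) / (1 - x))"
    using assms by (simp add: sum_gp_strict flip: sum_distrib_left)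
  also have "\<dots> \<le> x * (1 / (1 - x))"
    using assms by (intro mult_left_mono divide_right_mono) auto
  finally show ?thesis by simp
qed

definition gauss_quot :: "complex \<Rightarrow> nat \<Rightarrow> complex" where
  "gauss_quot q n = qprod (-1) q n / qprod 1 q n"

text \<open>Summand of a Shanks-type finite form of Gauss' identity. At \<open>s = 0\<close> the
  denominator \<open>1 + q ^ s\<close> is 2, so this term is half of
  \<open>gauss_quot q n\<close>.\<close>

definition theta_term :: "complex \<Rightarrow> nat \<Rightarrow> nat \<Rightarrow> complex" where
  "theta_term q n s = (-1) ^ s * gauss_quot q n / gauss_quot q s * q ^ (s * Suc n) / (1 + q ^ s)"

text \<open>The counterpart for the pentagonal number theorem; here the \<open>s = 0\<close> term is
  the full product \<open>qprod (-1) q n\<close>.\<close>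

definition penta_term :: "complex \<Rightarrow> nat \<Rightarrow> nat \<Rightarrow> complex" where
  "penta_term q n s = (-1) ^ s * qprod (-1) q n / qprod (-1) q s * q ^ (s * n + s * Suc s div 2)"

text \<open>Truncation of Euler's series for the inverse of the infinite product of
  \<open>1 - x * q ^ k\<close> over \<open>k \<ge> 0\<close>; at \<open>x = - q\<close> that product
  is the limit of \<open>qprod 1 q\<close>.\<close>

definition euler_sum :: "complex \<Rightarrow> nat \<Rightarrow> complex \<Rightarrow> complex" where
  "euler_sum q n x = (\<Sum>k\<le>n. x ^ k / qprod (-1) q k)"

context
  fixes q :: complex
  assumes q: "cmod q < 1"
begin

section \<open>Nonvanishing and uniform bounds of the products inside the unit disk\<close>

lemma norm_power_Suc_less_1: "cmod (q ^ Suc k) < 1"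
  using q power_Suc_less_one[of "cmod q" k] by (cases "q = 0") (auto simp: norm_power norm_mult)

lemma one_plus_nonzero:
  assumes "cmod c \<le> 1"
  shows "1 + c * q ^ Suc k \<noteq> 0"
proof
  assume "1 + c * q ^ Suc k = 0"
  hence "c * q ^ Suc k = - 1"
    by (simp add: add_eq_0_iff)
  hence "cmod c * cmod (q ^ Suc k) = 1"
    by (metis norm_mult norm_minus_cancel norm_one)
  moreover have "cmod c * cmod (q ^ Suc k) \<le> 1 * cmod (q ^ Suc k)"
    using assms by (intro mult_right_mono) auto
  ultimately show False
    using norm_power_Suc_less_1[of k] by linarith
qed

lemma qprod_nonzero:
  assumes "cmod c \<le> 1"
  shows "qprod c q n \<noteq> 0"
  by (induction n) (use one_plus_nonzero[OF assms] in \<open>auto simp: qprod_Suc\<close>)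

text \<open>Each factor is estimated by \<open>1 + t \<le> exp t\<close>, and the exponents form a
  geometric series, so the bound is uniform in \<open>n\<close>.\<close>

lemma norm_qprod_le:
  assumes "cmod c \<le> 1"
  shows "cmod (qprod c q n) \<le> exp (1 / (1 - cmod q))"
proof -
  have "cmod (qprod c q n) \<le> (\<Prod>k=1..n. exp (cmod q ^ k))"
    unfolding qprod_def prod_norm[symmetric]
  proof (rule prod_mono, safe)
    fix k assume "k \<in> {1..n}"
    have "cmod (1 + c * q ^ k) \<le> 1 + cmod c * cmod q ^ k"
      by (metis norm_triangle_ineq norm_one norm_mult norm_power)
    also have "\<dots> \<le> 1 + 1 * cmod q ^ k"
      using assms by (intro add_left_mono mult_right_mono) auto
    also have "\<dots> \<le> exp (cmod q ^ k)"
      using exp_ge_add_one_self[of "cmod q ^ k"] by simp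
    finally show "cmod (1 + c * q ^ k) \<le> exp (cmod q ^ k)" .
  qed auto
  also have "\<dots> = exp (\<Sum>k=1..n. cmod q ^ k)"
    by (simp add: exp_sum)
  also have "\<dots> \<le> exp (cmod q / (1 - cmod q))"
    using sum_power_le[of "cmod q" n] q by simp
  also have "\<dots> \<le> exp (1 / (1 - cmod q))"
    using q by (simp add: divide_right_mono)
  finally show ?thesis .
qed

text \<open>With \<open>r = cmod q\<close>, each inverse factor is at most
  \<open>1 / (1 - r ^ k) = 1 + r ^ k / (1 - r ^ k)\<close>, hence at most
  \<open>exp (r ^ k / (1 - r))\<close>, and the exponents again sum geometrically.\<close>

lemma norm_inverse_qprod_le:
  assumes "cmod c \<le> 1"
  shows "cmod (inverse (qprod c q n)) \<le> exp (1 / (1 - cmod q)\<^sup>2)"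
proof -
  define r where "r = cmod q"
  have r: "0 \<le> r" "r < 1"
    using q by (auto simp: r_def)
  have "cmod (inverse (qprod c q n)) = (\<Prod>k=1..n. inverse (cmod (1 + c * q ^ k)))"
    by (simp add: qprod_def norm_inverse o_def flip: prod_norm prod_inversef)
  also have "\<dots> \<le> (\<Prod>k=1..n. exp (r ^ k / (1 - r)))"
  proof (rule prod_mono, safe)
    fix k assume k: "k \<in> {1..n}"
    have rk: "r ^ k \<le> r"
      using k r power_decreasing[of 1 k r] by auto
    have "r ^ k = cmod (q ^ k)"
      by (simp add: r_def norm_power)
    moreover have "cmod (c * q ^ k) \<le> 1 * cmod (q ^ k)"
      unfolding norm_mult using assms by (intro mult_right_mono) auto
    moreover have "1 \<le> cmod (1 + c * q ^ k) + cmod (c * q ^ k)"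
      by (metis add_diff_cancel_right' norm_one norm_triangle_ineq4)
    ultimately have "1 - r ^ k \<le> cmod (1 + c * q ^ k)"
      by simp
    hence "inverse (cmod (1 + c * q ^ k)) \<le> inverse (1 - r ^ k)"
      using rk r by (intro le_imp_inverse_le) auto
    also have "\<dots> = 1 + r ^ k / (1 - r ^ k)"
      using rk r by (simp add: field_simps)
    also have "\<dots> \<le> 1 + r ^ k / (1 - r)"
      using rk r by (intro add_left_mono divide_left_mono) auto
    also have "\<dots> \<le> exp (r ^ k / (1 - r))"
      by (rule exp_ge_add_one_self)
    finally show "inverse (cmod (1 + c * q ^ k)) \<le> exp (r ^ k / (1 - r))" .
  qed auto
  also have "\<dots> = exp ((\<Sum>k=1..n. r ^ k) / (1 - r))"
    by (simp add: exp_sum sum_divide_distrib)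
  also have "\<dots> \<le> exp ((r / (1 - r)) / (1 - r))"
    by (simp only: exp_le_cancel_iff) (intro divide_right_mono sum_power_le, use r in auto)
  also have "\<dots> \<le> exp (1 / (1 - r)\<^sup>2)"
    using r by (simp add: power2_eq_square divide_right_mono)
  finally show ?thesis by (simp add: r_def)
qed

lemma qprod_bounded:
  obtains C where "C > 0"
    "\<And>c n. cmod c \<le> 1 \<Longrightarrow> cmod (qprod c q n) \<le> C"
    "\<And>c n. cmod c \<le> 1 \<Longrightarrow> cmod (inverse (qprod c q n)) \<le> C"
proof
  let ?C = "exp (1 / (1 - cmod q)) + exp (1 / (1 - cmod q)\<^sup>2)"
  show "?C > 0" by (simp add: add_pos_pos)
  show "cmod (qprod c q n) \<le> ?C" if "cmod c \<le> 1" for c n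
    using norm_qprod_le[OF that, of n] by (simp add: add_increasing2)
  show "cmod (inverse (qprod c q n)) \<le> ?C" if "cmod c \<le> 1" for c n
    using norm_inverse_qprod_le[OF that, of n] by (simp add: add_increasing)
qed

text \<open>For fixed \<open>n\<close> the bound is geometric in \<open>s\<close> with ratio
  \<open>cmod q ^ n\<close>, so summing from \<open>s = 1\<close> leaves a multiple of
  \<open>cmod q ^ n\<close>.\<close>

lemma error_sum_tendsto_0:
  fixes a :: "nat \<Rightarrow> nat \<Rightarrow> complex"
  assumes "\<And>n s. 1 \<le> s \<Longrightarrow> s \<le> n \<Longrightarrow> cmod (a n s) \<le> C * (cmod q ^ n) ^ s"
  shows "(\<lambda>n. \<Sum>s=1..n. a n s) \<longlonglongrightarrow> 0"
proof -
  define r where "r = cmod q"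
  have r: "0 \<le> r" "r < 1"
    using q by (auto simp: r_def)
  have bound: "cmod (\<Sum>s=1..n. a n s) \<le> \<bar>C\<bar> / (1 - r) * r ^ n" for n
  \<comment> \<open>For \<open>n = 0\<close> the ratio is 1 and the geometric bound breaks down, but
    the sum is empty.\<close>
  proof (cases "n = 0")
    case False
    hence rn: "0 \<le> r ^ n" "r ^ n \<le> r"
      using r power_decreasing[of 1 n r] by auto
    have "cmod (\<Sum>s=1..n. a n s) \<le> (\<Sum>s=1..n. \<bar>C\<bar> * (r ^ n) ^ s)"
    proof (rule order.trans[OF norm_sum sum_mono])
      fix s assume "s \<in> {1..n}"
      hence "cmod (a n s) \<le> C * (r ^ n) ^ s"
        using assms[of s n] by (simp add: r_def)
      also have "\<dots> \<le> \<bar>C\<bar> * (r ^ n) ^ s"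
        using rn by (intro mult_right_mono) auto
      finally show "cmod (a n s) \<le> \<bar>C\<bar> * (r ^ n) ^ s" .
    qed
    also have "\<dots> = \<bar>C\<bar> * (\<Sum>s=1..n. (r ^ n) ^ s)"
      by (simp add: sum_distrib_left)
    also have "\<dots> \<le> \<bar>C\<bar> * (r ^ n / (1 - r ^ n))"
      using sum_power_le[of "r ^ n" n] rn r by (intro mult_left_mono) auto
    also have "\<dots> \<le> \<bar>C\<bar> * (r ^ n / (1 - r))"
      using rn r by (intro mult_left_mono divide_left_mono) auto
    finally show ?thesis by simp
  qed (use r in auto)
  have "(\<lambda>n. \<bar>C\<bar> / (1 - r) * r ^ n) \<longlonglongrightarrow> \<bar>C\<bar> / (1 - r) * 0"
    using r by (intro tendsto_mult_left LIMSEQ_realpow_zero) auto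
  hence "(\<lambda>n. \<bar>C\<bar> / (1 - r) * r ^ n) \<longlonglongrightarrow> 0"
    by simp
  with bound show ?thesis
    by (rule Lim_null_comparison[OF always_eventually[OF allI]])
qed

lemma one_minus_power_nonzero: "1 - q ^ Suc k \<noteq> 0"
  using one_plus_nonzero[of "-1" k] by simp

lemma one_plus_power_nonzero: "1 + q ^ k \<noteq> 0"
  using one_plus_nonzero[of 1 "k - 1"] by (cases k) auto

lemma gauss_quot_0 [simp]: "gauss_quot q 0 = 1"
  by (simp add: gauss_quot_def)

lemma gauss_quot_Suc:
  "gauss_quot q (Suc n) = gauss_quot q n * (1 - q ^ Suc n) / (1 + q ^ Suc n)"
  by (simp add: gauss_quot_def qprod_Suc)

lemma gauss_quot_nonzero: "gauss_quot q n \<noteq> 0"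
  using qprod_nonzero by (simp add: gauss_quot_def)

subsection \<open>Gauss' theta identity\<close>

text \<open>As a function of \<open>s\<close>, the difference is \<open>V s - V (s + 1)\<close> with
  \<open>V s = (-1)\<^bsup>s+1\<^esup> G\<^sub>n q\<^bsup>s(n+1)\<^esup> / (G\<^sub>s\<^sub>-\<^sub>1 (1 + q\<^bsup>n+1\<^esup>))\<close>, where \<open>G\<close> is \<^const>\<open>gauss_quot\<close> and \<open>V 0 = 0\<close>.\<close>

lemma theta_term_telescope:
  "(\<Sum>s\<le>m. theta_term q (Suc n) s - theta_term q n s) =
     (-1) ^ Suc m * gauss_quot q n / gauss_quot q m * q ^ (Suc m * Suc n) / (1 + q ^ Suc n)"
proof (induction m)
  case 0
  define y where "y = q ^ Suc n"
  define w where "w = y / (1 + y)"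
  have w: "(1 - y) / (1 + y) = 1 - 2 * w"
    using one_plus_power_nonzero[of "Suc n", folded y_def] by (simp add: w_def field_simps)
  have "g * (1 - y) / (1 + y) / 2 - g / 2 = - (g * y / (1 + y))" for g
    unfolding times_divide_eq_right[symmetric] w w_def[symmetric]
    by (simp add: right_diff_distrib diff_divide_distrib)
  thus ?case
    by (simp add: theta_term_def gauss_quot_Suc y_def)
next
  case (Suc m)
  define x y z where "x = q ^ Suc m" and "y = q ^ Suc n" and "z = q ^ (Suc m * Suc n)"
  define g a where "g = gauss_quot q n" and "a = gauss_quot q m"
  note nz = one_plus_power_nonzero[of "Suc n", folded y_def] gauss_quot_nonzero[of m, folded a_def]
    one_minus_power_nonzero[of m, folded x_def] one_plus_power_nonzero[of "Suc m", folded x_def]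
  have e: "q ^ (Suc m * Suc (Suc n)) = x * z" "q ^ (Suc m * Suc n) = z"
    "q ^ (Suc (Suc m) * Suc n) = y * z"
    unfolding x_def y_def z_def power_add[symmetric] by (auto intro!: arg_cong[of _ _ "(^) q"])
  have d1: "theta_term q (Suc n) (Suc m) - theta_term q n (Suc m) =
          (-1) ^ Suc m * (g * (1 - y) / (1 + y)) / (a * (1 - x) / (1 + x)) * (x * z) / (1 + x) -
          (-1) ^ Suc m * g / (a * (1 - x) / (1 + x)) * z / (1 + x)"
    unfolding theta_term_def e gauss_quot_Suc x_def[symmetric] y_def[symmetric] g_def a_def ..
  have d2: "(-1) ^ Suc (Suc m) * gauss_quot q n / gauss_quot q (Suc m) * q ^ (Suc (Suc m) * Suc n) / (1 + q ^ Suc n) =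
          (-1) ^ Suc (Suc m) * g / (a * (1 - x) / (1 + x)) * (y * z) / (1 + y)"
    unfolding e gauss_quot_Suc x_def[symmetric] y_def[symmetric] g_def a_def ..
  \<comment> \<open>With the powers named, the induction step is a rational identity. The sign is
    written \<open>- 1 * u\<close> so that folding \<open>power_Suc\<close> yields
    \<open>(-1) ^ Suc (Suc m)\<close>.\<close>
  have d3: "u * g / a * z / (1 + y) +
      (u * (g * (1 - y) / (1 + y)) / (a * (1 - x) / (1 + x)) * (x * z) / (1 + x) -
       u * g / (a * (1 - x) / (1 + x)) * z / (1 + x)) =
      (- 1 * u) * g / (a * (1 - x) / (1 + x)) * (y * z) / (1 + y)" for u
    using nz by (simp add: divide_simps) (simp add: algebra_simps)
  show ?case
    unfolding sum.atMost_Suc Suc.IH d1 d2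
    unfolding g_def[symmetric] a_def[symmetric] z_def[symmetric] y_def[symmetric]
    by (rule d3[of "(-1) ^ Suc m", folded power_Suc])
qed

text \<open>Passing from \<open>n\<close> to \<open>n + 1\<close> contributes the telescoped
  boundary term and the new summand \<open>s = n + 1\<close>. With \<open>y = q ^ Suc n\<close> they
  carry the weights \<open>1 / (1 + y)\<close> and \<open>y / (1 + y)\<close>, which add up to
  1.\<close>

lemma sum_theta_term:
  "2 * (\<Sum>s\<le>n. theta_term q n s) = 1 + 2 * (\<Sum>k=1..n. (-1) ^ k * q ^ k\<^sup>2)"
proof (induction n)
  case (Suc n)
  define u y where "u = (- 1 :: complex) ^ Suc n" and "y = q ^ Suc n"
  have "q ^ (Suc n * Suc (Suc n)) = q ^ (Suc n)\<^sup>2 * y"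
    unfolding y_def power2_eq_square power_add[symmetric] by (rule arg_cong[of _ _ "(^) q"]) simp
  hence last: "theta_term q (Suc n) (Suc n) = u * (q ^ (Suc n)\<^sup>2 * y) / (1 + y)"
    using gauss_quot_nonzero[of "Suc n"] by (simp only: theta_term_def u_def y_def) simp
  have "(\<Sum>s\<le>Suc n. theta_term q (Suc n) s) - (\<Sum>s\<le>n. theta_term q n s) =
        (\<Sum>s\<le>n. theta_term q (Suc n) s - theta_term q n s) + theta_term q (Suc n) (Suc n)"
    by (simp add: sum_subtractf)
  also have "\<dots> = u * q ^ (Suc n)\<^sup>2 / (1 + y) + u * (q ^ (Suc n)\<^sup>2 * y) / (1 + y)"
    unfolding theta_term_telescope last using gauss_quot_nonzero[of n]
    by (simp add: u_def y_def power2_eq_square)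
  also have "\<dots> = u * q ^ (Suc n)\<^sup>2"
    using one_plus_power_nonzero[of "Suc n", folded y_def] by (simp add: divide_simps) (simp add: algebra_simps)
  finally have "2 * (\<Sum>s\<le>Suc n. theta_term q (Suc n) s) =
      2 * (\<Sum>s\<le>n. theta_term q n s) + 2 * (u * q ^ (Suc n)\<^sup>2)"
    by (simp only: diff_eq_eq distrib_left add.commute)
  also have "\<dots> = 1 + 2 * (\<Sum>k=1..Suc n. (-1) ^ k * q ^ k\<^sup>2)"
    unfolding Suc.IH by (simp add: u_def)
  finally show ?case .
qed (simp add: theta_term_def)

text \<open>Twice the \<open>s = 0\<close> summand is the quotient itself; the others are errors,
  thanks to the factor \<open>q ^ (s * Suc n)\<close>. Stating this for the difference avoids
  presupposing that either side converges.\<close>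

lemma gauss_quot_theta_diff_tendsto_0:
  "(\<lambda>n. gauss_quot q n - (1 + 2 * (\<Sum>k=1..n. (-1) ^ k * q ^ k\<^sup>2))) \<longlonglongrightarrow> 0"
proof -
  obtain C where C: "C > 0" "\<And>c n. cmod c \<le> 1 \<Longrightarrow> cmod (qprod c q n) \<le> C"
    "\<And>c n. cmod c \<le> 1 \<Longrightarrow> cmod (inverse (qprod c q n)) \<le> C"
    using qprod_bounded by blast
  have "(\<lambda>n. \<Sum>s=1..n. - 2 * theta_term q n s) \<longlonglongrightarrow> 0"
  proof (rule error_sum_tendsto_0)
    fix n s :: nat assume s: "1 \<le> s" "s \<le> n"
    have "gauss_quot q n / gauss_quot q s =
        qprod (-1) q n * inverse (qprod 1 q n) * (qprod 1 q s * inverse (qprod (-1) q s))"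
      by (simp add: gauss_quot_def field_simps)
    also have "cmod \<dots> \<le> (C * C) * (C * C)"
      unfolding norm_mult using C by (intro mult_mono) auto
    finally have 1: "cmod (gauss_quot q n / gauss_quot q s) \<le> (C * C) * (C * C)" .
    have "cmod (q ^ s) \<le> cmod q"
      using s q power_decreasing[of 1 s "cmod q"] by (simp add: norm_power)
    moreover have "1 \<le> cmod (1 + q ^ s) + cmod (q ^ s)"
      by (metis add_diff_cancel_right' norm_one norm_triangle_ineq4)
    ultimately have 2: "cmod (inverse (1 + q ^ s)) \<le> inverse (1 - cmod q)"
      using q unfolding norm_inverse by (intro le_imp_inverse_le) auto
    have "cmod (q ^ (s * Suc n)) = (cmod q ^ n) ^ s * cmod q ^ s"
      by (simp add: norm_power norm_mult power_add power_mult[symmetric] mult.commute)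
    also have "\<dots> \<le> (cmod q ^ n) ^ s * 1"
      using q by (intro mult_left_mono power_le_one) auto
    finally have 3: "cmod (q ^ (s * Suc n)) \<le> (cmod q ^ n) ^ s" by simp
    have "cmod (- 2 * theta_term q n s) =
        2 * (cmod (gauss_quot q n / gauss_quot q s) * cmod (q ^ (s * Suc n)) * cmod (inverse (1 + q ^ s)))"
      by (simp add: theta_term_def norm_mult norm_divide norm_power norm_inverse divide_inverse)
    also have "\<dots> \<le> 2 * (((C * C) * (C * C)) * (cmod q ^ n) ^ s * inverse (1 - cmod q))"
      using C q by (intro mult_left_mono mult_mono 1 2 3) auto
    finally show "cmod (- 2 * theta_term q n s) \<le>
        (2 * ((C * C) * (C * C)) * inverse (1 - cmod q)) * (cmod q ^ n) ^ s"
      by (simp add: mult_ac)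
  qed
  moreover have "(\<Sum>s=1..n. - 2 * theta_term q n s) =
      gauss_quot q n - (1 + 2 * (\<Sum>k=1..n. (-1) ^ k * q ^ k\<^sup>2))" for n
  proof -
    have "(\<Sum>s\<le>n. theta_term q n s) = theta_term q n 0 + (\<Sum>s=1..n. theta_term q n s)"
      unfolding atMost_atLeast0 by (subst sum.atLeast_Suc_atMost) auto
    moreover have "theta_term q n 0 = gauss_quot q n / 2"
      by (simp add: theta_term_def)
    ultimately show ?thesis
      unfolding sum_theta_term[symmetric] sum_distrib_left[symmetric] by (simp add: algebra_simps)
  qed
  ultimately show ?thesis by simp
qed

subsection \<open>The pentagonal number theorem\<close>

lemma penta_term_telescope:
  "(\<Sum>s\<le>m. penta_term q (Suc n) s - penta_term q n s) =
     (-1) ^ Suc m * qprod (-1) q n / qprod (-1) q m * q ^ (Suc m * n + Suc m * Suc (Suc m) div 2)"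
proof (induction m)
  case 0
  show ?case
    by (simp add: penta_term_def qprod_Suc algebra_simps)
next
  case (Suc m)
  define x y z where "x = q ^ Suc m" and "y = q ^ Suc n"
    and "z = q ^ (Suc m * n + Suc m * Suc (Suc m) div 2)"
  define g a where "g = qprod (-1) q n" and "a = qprod (-1) q m"
  note nz = qprod_nonzero[of "-1" m, folded a_def] one_minus_power_nonzero[of m, folded x_def]
  have "Suc (Suc m) * Suc (Suc (Suc m)) div 2 = Suc m * Suc (Suc m) div 2 + Suc (Suc m)"
    by simp
  hence e: "q ^ (Suc m * Suc n + Suc m * Suc (Suc m) div 2) = x * z"
    "q ^ (Suc (Suc m) * n + Suc (Suc m) * Suc (Suc (Suc m)) div 2) = x * y * z"
    unfolding x_def y_def z_def power_add[symmetric] by (auto intro!: arg_cong[of _ _ "(^) q"])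
  have d1: "penta_term q (Suc n) (Suc m) - penta_term q n (Suc m) =
          (-1) ^ Suc m * (g * (1 + (-1) * y)) / (a * (1 + (-1) * x)) * (x * z) -
          (-1) ^ Suc m * g / (a * (1 + (-1) * x)) * z"
    unfolding penta_term_def e qprod_Suc x_def[symmetric] y_def[symmetric] z_def[symmetric] g_def a_def ..
  have d2: "(-1) ^ Suc (Suc m) * qprod (-1) q n / qprod (-1) q (Suc m) *
        q ^ (Suc (Suc m) * n + Suc (Suc m) * Suc (Suc (Suc m)) div 2) =
        (-1) ^ Suc (Suc m) * g / (a * (1 + (-1) * x)) * (x * y * z)"
    unfolding e qprod_Suc x_def[symmetric] g_def a_def ..
  have d3: "u * g / a * z + (u * (g * (1 + (-1) * y)) / (a * (1 + (-1) * x)) * (x * z) -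
       u * g / (a * (1 + (-1) * x)) * z) = (- 1 * u) * g / (a * (1 + (-1) * x)) * (x * y * z)" for u
    using nz by (simp add: divide_simps) (simp add: algebra_simps)
  show ?case
    unfolding sum.atMost_Suc Suc.IH d1 d2
    unfolding g_def[symmetric] a_def[symmetric] z_def[symmetric]
    by (rule d3[of "(-1) ^ Suc m", folded power_Suc])
qed

text \<open>In the step to \<open>n + 1\<close> the telescoped boundary term has the pentagonal
  exponent \<open>k * (3 * k - 1) div 2\<close> and the new summand the exponent
  \<open>k * (3 * k + 1) div 2\<close>, both for \<open>k = n + 1\<close>.\<close>

lemma sum_penta_term:
  "(\<Sum>s\<le>n. penta_term q n s) =
     1 + (\<Sum>k=1..n. (-1) ^ k * (q ^ (k * (3 * k - 1) div 2) + q ^ (k * (3 * k + 1) div 2)))"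
proof (induction n)
  case (Suc n)
  define u where "u = (- 1 :: complex) ^ Suc n"
  have nz: "qprod (-1) q k \<noteq> 0" for k
    using qprod_nonzero[of "-1" k] by simp
  have e1: "Suc n * n + Suc n * Suc (Suc n) div 2 = Suc n * (3 * Suc n - 1) div 2"
  proof -
    have "Suc n * (3 * Suc n - 1) = 2 * (Suc n * n) + Suc n * Suc (Suc n)"
      by (simp add: algebra_simps)
    thus ?thesis by simp
  qed
  have e2: "Suc n * Suc n + Suc n * Suc (Suc n) div 2 = Suc n * (3 * Suc n + 1) div 2"
  proof -
    have "Suc n * (3 * Suc n + 1) = 2 * (Suc n * Suc n) + Suc n * Suc (Suc n)"
      by (simp add: algebra_simps)
    thus ?thesis by simp
  qed
  have "(\<Sum>s\<le>Suc n. penta_term q (Suc n) s) - (\<Sum>s\<le>n. penta_term q n s) =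
        (\<Sum>s\<le>n. penta_term q (Suc n) s - penta_term q n s) + penta_term q (Suc n) (Suc n)"
    by (simp add: sum_subtractf)
  also have "\<dots> = u * (q ^ (Suc n * (3 * Suc n - 1) div 2) + q ^ (Suc n * (3 * Suc n + 1) div 2))"
    unfolding penta_term_telescope unfolding penta_term_def e1 e2 u_def[symmetric]
    by (simp only: nonzero_mult_div_cancel_right[OF nz] distrib_left)
  finally have "(\<Sum>s\<le>Suc n. penta_term q (Suc n) s) = (\<Sum>s\<le>n. penta_term q n s) +
      u * (q ^ (Suc n * (3 * Suc n - 1) div 2) + q ^ (Suc n * (3 * Suc n + 1) div 2))"
    by (simp only: diff_eq_eq add.commute)
  also have "\<dots> = 1 + (\<Sum>k=1..Suc n. (-1) ^ k * (q ^ (k * (3 * k - 1) div 2) + q ^ (k * (3 * k + 1) div 2)))"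
    unfolding Suc.IH u_def by (subst sum.nat_ivl_Suc', simp, simp only: add_ac)
  finally show ?case .
qed (simp add: penta_term_def)

text \<open>The product is the \<open>s = 0\<close> summand, and the factor
  \<open>q ^ (s * n)\<close> makes the remaining ones errors.\<close>

lemma qprod_penta_diff_tendsto_0:
  "(\<lambda>n. qprod (-1) q n -
     (1 + (\<Sum>k=1..n. (-1) ^ k * (q ^ (k * (3 * k - 1) div 2) + q ^ (k * (3 * k + 1) div 2)))))
     \<longlonglongrightarrow> 0"
proof -
  obtain C where C: "C > 0" "\<And>c n. cmod c \<le> 1 \<Longrightarrow> cmod (qprod c q n) \<le> C"
    "\<And>c n. cmod c \<le> 1 \<Longrightarrow> cmod (inverse (qprod c q n)) \<le> C"
    using qprod_bounded by blast
  have "(\<lambda>n. \<Sum>s=1..n. - penta_term q n s) \<longlonglongrightarrow> 0"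
  proof (rule error_sum_tendsto_0)
    fix n s :: nat assume s: "1 \<le> s" "s \<le> n"
    have "cmod (q ^ (s * n + s * Suc s div 2)) = (cmod q ^ n) ^ s * cmod q ^ (s * Suc s div 2)"
      by (simp add: norm_power norm_mult power_add power_mult[symmetric] mult.commute)
    also have "\<dots> \<le> (cmod q ^ n) ^ s * 1"
      using q by (intro mult_left_mono power_le_one) auto
    finally have 1: "cmod (q ^ (s * n + s * Suc s div 2)) \<le> (cmod q ^ n) ^ s" by simp
    have "cmod (- penta_term q n s) = cmod (qprod (-1) q n) * cmod (inverse (qprod (-1) q s)) *
        cmod (q ^ (s * n + s * Suc s div 2))"
      by (simp add: penta_term_def norm_mult norm_divide norm_power norm_inverse divide_inverse)
    also have "\<dots> \<le> C * C * (cmod q ^ n) ^ s"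
      using C q by (intro mult_mono 1) auto
    finally show "cmod (- penta_term q n s) \<le> (C * C) * (cmod q ^ n) ^ s" .
  qed
  moreover have "(\<Sum>s=1..n. - penta_term q n s) = qprod (-1) q n - (\<Sum>s\<le>n. penta_term q n s)" for n
  proof -
    have "(\<Sum>s\<le>n. penta_term q n s) = penta_term q n 0 + (\<Sum>s=1..n. penta_term q n s)"
      unfolding atMost_atLeast0 by (subst sum.atLeast_Suc_atMost) auto
    moreover have "penta_term q n 0 = qprod (-1) q n"
      by (simp add: penta_term_def)
    ultimately show ?thesis
      by (simp add: sum_negf)
  qed
  ultimately show ?thesis by (simp add: sum_penta_term)
qed

subsection \<open>Euler's series for the inverse product\<close>

text \<open>Finite form of the functional equation \<open>E (x * q) = (1 - x) * E x\<close> of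
  Euler's series, with the truncation error added. It rests on \<open>q ^ k / P\<^sub>k = 1 /
  P\<^sub>k - 1 / P\<^sub>k\<^sub>-\<^sub>1\<close>.\<close>

lemma euler_sum_shift:
  "euler_sum q n (x * q) = (1 - x) * euler_sum q n x + x ^ Suc n / qprod (-1) q n"
proof (induction n)
  case (Suc n)
  have "X * y / (p * (1 + (-1) * y)) = X / (p * (1 + (-1) * y)) - X / p"
    if "p \<noteq> 0" "1 - y \<noteq> 0" for X y p :: complex
    using that by (simp add: divide_simps) (simp add: algebra_simps)
  from this[OF qprod_nonzero one_minus_power_nonzero]
  have *: "(x * q) ^ Suc n / qprod (-1) q (Suc n) =
      x ^ Suc n / qprod (-1) q (Suc n) - x ^ Suc n / qprod (-1) q n"
    unfolding qprod_Suc power_mult_distrib by simp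
  have "euler_sum q (Suc n) (x * q) = euler_sum q n (x * q) + (x * q) ^ Suc n / qprod (-1) q (Suc n)"
    by (simp add: euler_sum_def)
  also have "\<dots> = (1 - x) * (euler_sum q n x + x ^ Suc n / qprod (-1) q (Suc n)) +
      x * (x ^ Suc n / qprod (-1) q (Suc n))"
    unfolding Suc.IH * by (simp only: ring_distribs) simp
  also have "euler_sum q n x + x ^ Suc n / qprod (-1) q (Suc n) = euler_sum q (Suc n) x"
    by (simp add: euler_sum_def)
  finally show ?case by simp
qed (simp add: euler_sum_def)

text \<open>The shift is applied at \<open>x = - (q ^ k)\<close> for \<open>k = 1, ..., m\<close>,
  and the factors \<open>1 + q ^ k\<close> are divided out. This pushes the argument towards 0,
  where only the constant term of the series matters.\<close>

lemma euler_sum_iterate: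
  "euler_sum q n (- (q ^ Suc m)) / qprod 1 q m = euler_sum q n (- q) +
     (\<Sum>k=1..m. (- (q ^ k)) ^ Suc n / (qprod (-1) q n * qprod 1 q k))"
proof (induction m)
  case (Suc m)
  have nz: "qprod 1 q m \<noteq> 0" "1 + q ^ Suc m \<noteq> 0"
    using qprod_nonzero[of 1 m] one_plus_power_nonzero[of "Suc m"] by auto
  have shift: "euler_sum q n (- (q ^ Suc (Suc m))) =
      (1 + q ^ Suc m) * euler_sum q n (- (q ^ Suc m)) + (- (q ^ Suc m)) ^ Suc n / qprod (-1) q n"
    using euler_sum_shift[of n "- (q ^ Suc m)"] by (simp add: mult_ac)
  have "((1 + b) * e + c) / (a * (1 + b)) = e / a + c / (a * (1 + b))"
    if "a \<noteq> 0" "1 + b \<noteq> 0" for a b c e :: complex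
    using that by (simp add: add_divide_distrib)
  note this[OF nz, of "euler_sum q n (- (q ^ Suc m))" "(- (q ^ Suc m)) ^ Suc n / qprod (-1) q n"]
  hence "euler_sum q n (- (q ^ Suc (Suc m))) / qprod 1 q (Suc m) =
      euler_sum q n (- (q ^ Suc m)) / qprod 1 q m +
      (- (q ^ Suc m)) ^ Suc n / (qprod (-1) q n * qprod 1 q (Suc m))"
    unfolding shift qprod_Suc[of 1] mult_1_left divide_divide_eq_left .
  thus ?case
    unfolding Suc.IH by simp
qed simp

lemma euler_sum_gauss_quot_diff_tendsto_0:
  "(\<lambda>n. qprod (-1) q n * euler_sum q n (- q) - gauss_quot q n) \<longlonglongrightarrow> 0"
proof -
  obtain C where C: "C > 0" "\<And>c n. cmod c \<le> 1 \<Longrightarrow> cmod (qprod c q n) \<le> C"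
    "\<And>c n. cmod c \<le> 1 \<Longrightarrow> cmod (inverse (qprod c q n)) \<le> C"
    using qprod_bounded by blast
  \<comment> \<open>The first part collects the nonconstant terms of the truncated series at
    \<open>- (q ^ Suc n)\<close>, the second the truncation errors of
    \<open>euler_sum_iterate\<close> for \<open>m = n\<close>.\<close>
  define a where "a n s = (- (q ^ Suc n)) ^ s * (qprod (-1) q n * inverse (qprod (-1) q s) * inverse (qprod 1 q n))
      - (- (q ^ s)) ^ Suc n * inverse (qprod 1 q s)" for n s
  have "(\<lambda>n. \<Sum>s=1..n. a n s) \<longlonglongrightarrow> 0"
  proof (rule error_sum_tendsto_0)
    fix n s :: nat assume s: "1 \<le> s" "s \<le> n"
    have "(cmod q ^ n) ^ s * cmod q ^ s \<le> (cmod q ^ n) ^ s * 1"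
      using q by (intro mult_left_mono power_le_one) auto
    hence 1: "cmod ((- (q ^ Suc n)) ^ s) \<le> (cmod q ^ n) ^ s" "cmod ((- (q ^ s)) ^ Suc n) \<le> (cmod q ^ n) ^ s"
      by (simp_all add: norm_power norm_mult power_mult_distrib mult.commute flip: power_mult)
    have "cmod (a n s) \<le> cmod ((- (q ^ Suc n)) ^ s) *
         (cmod (qprod (-1) q n) * cmod (inverse (qprod (-1) q s)) * cmod (inverse (qprod 1 q n))) +
        cmod ((- (q ^ s)) ^ Suc n) * cmod (inverse (qprod 1 q s))"
      unfolding a_def norm_mult[symmetric] by (rule norm_triangle_ineq4)
    also have "\<dots> \<le> (cmod q ^ n) ^ s * (C * C * C) + (cmod q ^ n) ^ s * C"
      using C by (intro add_mono mult_mono 1) auto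
    finally show "cmod (a n s) \<le> (C * C * C + C) * (cmod q ^ n) ^ s"
      by (simp add: algebra_simps)
  qed
  moreover have "(\<Sum>s=1..n. a n s) = qprod (-1) q n * euler_sum q n (- q) - gauss_quot q n" for n
  proof -
    have nz: "qprod (-1) q n \<noteq> 0"
      using qprod_nonzero by auto
    have cancel: "qprod (-1) q n * (x / (qprod (-1) q n * y)) = x * inverse y" for x y
      using nz by (simp add: divide_inverse)
    have "euler_sum q n x = 1 + (\<Sum>s=1..n. x ^ s / qprod (-1) q s)" for x
      unfolding euler_sum_def atMost_atLeast0 by (subst sum.atLeast_Suc_atMost) auto
    hence "gauss_quot q n + (\<Sum>s=1..n. (- (q ^ Suc n)) ^ s * (qprod (-1) q n * inverse (qprod (-1) q s) * inverse (qprod 1 q n))) =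
        qprod (-1) q n * (euler_sum q n (- (q ^ Suc n)) / qprod 1 q n)"
      by (simp add: gauss_quot_def divide_inverse distrib_left distrib_right
            sum_distrib_left sum_distrib_right mult_ac)
    also have "\<dots> = qprod (-1) q n * euler_sum q n (- q) + (\<Sum>s=1..n. (- (q ^ s)) ^ Suc n * inverse (qprod 1 q s))"
      unfolding euler_sum_iterate distrib_left sum_distrib_left cancel ..
    finally show ?thesis
      unfolding a_def sum_subtractf by (simp add: algebra_simps)
  qed
  ultimately show ?thesis by simp
qed

end

subsection \<open>Distinct partitions by smallest part\<close>

text \<open>\<open>has_sum\<close> is a limit along all finite subsets, so any family of finite sets
  that eventually absorbs each of them computes it. It serves both for partitions and for the
  bilateral series.\<close>

lemma has_sum_imp_exhaustion_tendsto:
  assumes "(f has_sum x) A"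
    and "\<And>n. finite (B n)" "\<And>n. B n \<subseteq> A"
    and "\<And>X. finite X \<Longrightarrow> X \<subseteq> A \<Longrightarrow> eventually (\<lambda>n. X \<subseteq> B n) F"
  shows "((\<lambda>n. sum f (B n)) \<longlongrightarrow> x) F"
proof -
  have "filterlim B (finite_subsets_at_top A) F"
    unfolding filterlim_finite_subsets_at_top using assms(2-4) by (auto elim: eventually_mono)
  with assms(1) show ?thesis
    unfolding has_sum_def by (rule filterlim_compose)
qed

text \<open>Nonempty partitions into distinct parts, encoded as sets of parts.\<close>

definition min_sets :: "nat set \<Rightarrow> nat set set" where
  "min_sets S = {A. finite A \<and> A \<noteq> {} \<and> 0 \<notin> A \<and> Min A \<in> S}"

definition set_term :: "complex \<Rightarrow> nat set \<Rightarrow> complex" where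
  "set_term q A = - ((-1) ^ card A) * q ^ \<Sum>A"

lemma F_term_mset_set:
  assumes "finite A" "A \<noteq> {}"
  shows "F_term q (mset_set A) = set_term q A"
proof -
  have "\<not> (\<exists>i. count (mset_set A) i \<ge> 2)"
    by (auto simp: count_mset_set' not_le)
  moreover have "mset_set A \<noteq> {#}"
    using assms by (simp add: mset_set_empty_iff)
  moreover have "sum_mset (mset_set A) = \<Sum>A"
    by (simp add: sum_unfold_sum_mset)
  ultimately show ?thesis
    by (simp add: F_term_def part_mu_star_def part_mu_def set_term_def)
qed

text \<open>A repeated part makes the term vanish, and \<open>mset_set\<close> identifies the
  remaining partitions with sets. The equivalence transfers summability and value at once.\<close>

lemma has_sum_F_term_iff:
  "(F_term q has_sum x) (partitions_sm S) \<longleftrightarrow> (set_term q has_sum x) (min_sets S)"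
proof -
  have sub: "mset_set ` min_sets S \<subseteq> partitions_sm S"
    by (auto simp: min_sets_def partitions_sm_def partitions_def smallest_part_def mset_set_empty_iff
        intro!: gr0I)
  have zero: "F_term q p = 0" if p: "p \<in> partitions_sm S - mset_set ` min_sets S" for p
  proof -
    have "\<exists>i. count p i \<ge> 2"
    proof (rule ccontr)
      assume *: "\<not> (\<exists>i. count p i \<ge> 2)"
      have "p = mset_set (set_mset p)"
      proof (rule multiset_eqI)
        fix i
        have "count p i = 0 \<or> count p i = 1"
          using * by (metis One_nat_def Suc_1 le_neq_implies_less less_2_cases not_less_eq_eq nat_le_linear)
        thus "count p i = count (mset_set (set_mset p)) i"
          by (auto simp: count_mset_set' count_eq_zero_iff)
      qed
      moreover have "set_mset p \<in> min_sets S"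
        using p by (auto simp: min_sets_def partitions_sm_def partitions_def smallest_part_def)
      ultimately show False
        using p by blast
    qed
    thus ?thesis
      by (auto simp: F_term_def part_mu_star_def part_mu_def)
  qed
  have "(F_term q has_sum x) (partitions_sm S) \<longleftrightarrow> (F_term q has_sum x) (mset_set ` min_sets S)"
    by (rule has_sum_cong_neutral) (use sub zero in auto)
  also have "\<dots> \<longleftrightarrow> ((F_term q \<circ> mset_set) has_sum x) (min_sets S)"
    by (rule has_sum_reindex) (auto intro!: inj_onI simp: min_sets_def mset_set_eq_iff)
  also have "\<dots> \<longleftrightarrow> (set_term q has_sum x) (min_sets S)"
    by (rule has_sum_cong) (auto simp: F_term_mset_set min_sets_def)
  finally show ?thesis .
qed

section \<open>Recursion on the bound for the parts, and convergence\<close>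

definition min_sets_upto :: "nat set \<Rightarrow> nat \<Rightarrow> nat set set" where
  "min_sets_upto S n = {A \<in> min_sets S. A \<subseteq> {..n}}"

lemma finite_min_sets_upto: "finite (min_sets_upto S n)"
  by (rule finite_subset[of _ "Pow {..n}"]) (auto simp: min_sets_upto_def)

lemma min_sets_upto_0: "min_sets_upto S 0 = {}"
  by (auto simp: min_sets_upto_def min_sets_def)

text \<open>A new largest element leaves the minimum of a nonempty set unchanged; added to the empty
  set, it becomes the minimum itself, whence the case distinction on \<open>S\<close>.\<close>

lemma min_sets_upto_Suc:
  "min_sets_upto S (Suc n) = min_sets_upto S n \<union>
     (insert (Suc n) ` min_sets_upto S n \<union> (if Suc n \<in> S then {{Suc n}} else {}))"
  (is "?L = ?R")
proof -
  have Min_insert_Suc: "Min (insert (Suc n) B) = Min B" if "B \<subseteq> {..n}" "B \<noteq> {}" for B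
  proof -
    have "finite B" using that finite_subset by blast
    hence "Min B \<in> B" using that by simp
    hence "Min B \<le> n" using that by blast
    thus ?thesis using \<open>finite B\<close> that by simp
  qed
  show ?thesis
  proof (intro equalityI subsetI)
    fix A assume A: "A \<in> ?L"
    define B where "B = A - {Suc n}"
    have A': "finite A" "A \<noteq> {}" "0 \<notin> A" "Min A \<in> S" "A \<subseteq> {..Suc n}"
      using A by (simp_all add: min_sets_upto_def min_sets_def)
    have B: "B \<subseteq> {..n}" "finite B" "0 \<notin> B"
      using A' by (auto simp: B_def atMost_Suc)
    have "A = B \<or> A = {Suc n} \<or> B \<noteq> {} \<and> A = insert (Suc n) B"
      unfolding B_def by blast
    then consider "A = B" | "A = {Suc n}" | "B \<noteq> {}" "A = insert (Suc n) B"
      by blast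
    thus "A \<in> ?R"
    proof cases
      case 1
      hence "A \<in> min_sets_upto S n"
        using A' B by (simp add: min_sets_upto_def min_sets_def)
      thus ?thesis by blast
    next
      case 2
      hence "Suc n \<in> S" using A' by simp
      thus ?thesis using 2 by simp
    next
      case 3
      hence "Min B \<in> S"
        using A' Min_insert_Suc[OF B(1)] by simp
      hence "B \<in> min_sets_upto S n"
        using B 3(1) by (simp add: min_sets_upto_def min_sets_def)
      thus ?thesis using 3(2) by blast
    qed
  next
    fix A assume "A \<in> ?R"
    then consider "A \<in> min_sets_upto S n" | B where "B \<in> min_sets_upto S n" "A = insert (Suc n) B"
      | "Suc n \<in> S" "A = {Suc n}"
      by (auto split: if_splits)
    thus "A \<in> ?L"
    proof cases
      case 2
      hence B: "finite B" "B \<noteq> {}" "0 \<notin> B" "Min B \<in> S" "B \<subseteq> {..n}"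
        by (simp_all add: min_sets_upto_def min_sets_def)
      moreover have "B \<subseteq> {..Suc n}"
        using B(5) by (auto simp: atMost_Suc)
      ultimately show ?thesis
        unfolding 2(2) min_sets_upto_def min_sets_def mem_Collect_eq Min_insert_Suc[OF B(5,2)] by simp
    qed (auto simp: min_sets_upto_def min_sets_def)
  qed
qed

text \<open>Inserting \<open>Suc n\<close> flips the sign and multiplies by
  \<open>q ^ Suc n\<close>; the singleton enters with a positive sign.\<close>

lemma sum_set_term_Suc:
  "(\<Sum>A\<in>min_sets_upto S (Suc n). set_term q A) =
     (1 - q ^ Suc n) * (\<Sum>A\<in>min_sets_upto S n. set_term q A) + (if Suc n \<in> S then q ^ Suc n else 0)"
proof -
  have notin: "Suc n \<notin> A" if "A \<in> min_sets_upto S n" for A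
    using that by (auto simp: min_sets_upto_def)
  have nonempty: "A \<noteq> {}" "finite A" if "A \<in> min_sets_upto S n" for A
    using that by (auto simp: min_sets_upto_def min_sets_def)
  have inj: "inj_on (insert (Suc n)) (min_sets_upto S n)"
    by (intro inj_onI) (use notin in \<open>metis insert_ident\<close>)
  have "(\<Sum>A\<in>min_sets_upto S (Suc n). set_term q A) =
      (\<Sum>A\<in>min_sets_upto S n. set_term q A) +
      ((\<Sum>A\<in>insert (Suc n) ` min_sets_upto S n. set_term q A) +
       (\<Sum>A\<in>(if Suc n \<in> S then {{Suc n}} else {}). set_term q A))"
    unfolding min_sets_upto_Suc using finite_min_sets_upto[of S n] notin nonempty
    by (subst sum.union_disjoint; (subst sum.union_disjoint)?) (auto split: if_splits)
  also have "(\<Sum>A\<in>insert (Suc n) ` min_sets_upto S n. set_term q A) =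
      (\<Sum>A\<in>min_sets_upto S n. - (q ^ Suc n) * set_term q A)"
    unfolding sum.reindex[OF inj] using notin nonempty
    by (intro sum.cong refl) (simp add: set_term_def power_add mult_ac)
  also have "\<dots> = - (q ^ Suc n) * (\<Sum>A\<in>min_sets_upto S n. set_term q A)"
    by (simp only: sum_distrib_left)
  also have "(\<Sum>A\<in>(if Suc n \<in> S then {{Suc n}} else {}). set_term q A) =
      (if Suc n \<in> S then q ^ Suc n else 0)"
    by (simp add: set_term_def)
  finally show ?thesis
    by (simp add: algebra_simps)
qed

text \<open>A finite sum of absolute values is part of the expansion of the product of
  \<open>1 + r ^ k\<close>, which is again a \<open>qprod\<close>, taken at the real base
  \<open>r\<close>, and so is bounded by \<open>norm_qprod_le\<close>.\<close>

lemma set_term_summable_on: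
  assumes q: "cmod q < 1"
  shows "set_term q summable_on min_sets S"
proof -
  define r where "r = cmod q"
  have r: "0 \<le> r" "r < 1"
    using q by (auto simp: r_def)
  have "(\<Sum>A\<in>X. norm (set_term q A)) \<le> exp (1 / (1 - r))" if X: "X \<subseteq> min_sets S" "finite X" for X
  proof -
    have "finite (\<Union>X)"
      using X by (auto simp: min_sets_def)
    then obtain n where "\<Union>X \<subseteq> {..n}"
      using finite_nat_iff_bounded_le by blast
    hence sub: "X \<subseteq> Pow {1..n}"
      using X by (force simp: min_sets_def Suc_le_eq intro!: gr0I)
    have "(\<Sum>A\<in>X. norm (set_term q A)) = (\<Sum>A\<in>X. \<Prod>k\<in>A. r ^ k)"
      by (simp add: set_term_def norm_mult norm_power r_def power_sum flip: prod_norm)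
    also have "\<dots> \<le> (\<Sum>A\<in>Pow {1..n}. \<Prod>k\<in>A. r ^ k)"
      using sub r by (intro sum_mono2 prod_nonneg) auto
    also have "\<dots> = (\<Prod>k=1..n. r ^ k + 1)"
      by (subst prod_add) auto
    also have "\<dots> = cmod (qprod 1 (of_real r) n)"
    proof -
      have "cmod (1 + (of_real r) ^ k) = r ^ k + 1" for k
      proof -
        have "1 + (of_real r) ^ k = complex_of_real (r ^ k + 1)"
          by simp
        thus ?thesis
          using r by (metis abs_of_nonneg add_nonneg_nonneg norm_of_real zero_le_one zero_le_power)
      qed
      thus ?thesis
        by (simp add: qprod_def flip: prod_norm)
    qed
    also have "\<dots> \<le> exp (1 / (1 - r))"
      using norm_qprod_le[of "of_real r" 1 n] r by simp
    finally show ?thesis .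
  qed
  hence "(\<lambda>A. norm (set_term q A)) summable_on min_sets S"
    unfolding abs_summable_iff_bdd_above by (intro bdd_aboveI2) auto
  thus ?thesis
    by (rule abs_summable_summable)
qed

lemma F_term_summable_on:
  assumes "cmod q < 1"
  shows "F_term q summable_on partitions_sm S"
  using set_term_summable_on[OF assms, of S] unfolding summable_on_def has_sum_F_term_iff .

lemma sum_set_term_tendsto_F_part:
  assumes "cmod q < 1"
  shows "(\<lambda>n. \<Sum>A\<in>min_sets_upto S n. set_term q A) \<longlonglongrightarrow> F_part S q"
proof (rule has_sum_imp_exhaustion_tendsto)
  show "(set_term q has_sum F_part S q) (min_sets S)"
    using F_term_summable_on[OF assms, of S]
    unfolding F_part_def has_sum_F_term_iff[symmetric] by (rule has_sum_infsum)
  show "finite (min_sets_upto S n)" for n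
    by (rule finite_min_sets_upto)
  show "min_sets_upto S n \<subseteq> min_sets S" for n
    by (auto simp: min_sets_upto_def)
  show "eventually (\<lambda>n. X \<subseteq> min_sets_upto S n) sequentially" if X: "finite X" "X \<subseteq> min_sets S" for X
  proof -
    have "finite (\<Union>X)"
      using X by (auto simp: min_sets_def)
    then obtain n where n: "\<Union>X \<subseteq> {..n}"
      using finite_nat_iff_bounded_le by blast
    show ?thesis
      using eventually_ge_at_top[of n]
    proof eventually_elim
      case (elim m)
      have "\<Union>X \<subseteq> {..m}"
        using n elim by (meson atMost_subset_iff order_trans)
      thus ?case
        using X by (auto simp: min_sets_upto_def)
    qed
  qed
qed

section \<open>The two residue classes modulo 2\<close>

lemma mem_res_class_1_2: "n \<in> res_class 1 2 \<longleftrightarrow> odd n"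
  by (auto simp: res_class_def cong_def odd_iff_mod_2_eq_one intro!: gr0I)

lemma mem_res_class_2_2: "n \<in> res_class 2 2 \<longleftrightarrow> n > 0 \<and> even n"
  by (auto simp: res_class_def cong_def even_iff_mod_2_eq_zero)

text \<open>Passing to \<open>1 - 2 * Z\<close> balances the recursion: the inhomogeneous term
  becomes \<open>(- q) ^ Suc n\<close> for either parity. Division by the product then leaves a
  plain sum.\<close>

lemma sum_set_term_odd:
  assumes q: "cmod q < 1"
  shows "1 - 2 * (\<Sum>A\<in>min_sets_upto (res_class 1 2) n. set_term q A) =
    qprod (-1) q n * euler_sum q n (- q)"
proof (induction n)
  case (Suc n)
  have sgn: "1 - y - 2 * (if Suc n \<in> res_class 1 2 then y else 0) + y = (-1) ^ Suc n * y + (1 - y)" for y :: complex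
    by (auto simp: mem_res_class_1_2 simp del: One_nat_def)
  define Z where "Z = (\<Sum>A\<in>min_sets_upto (res_class 1 2) n. set_term q A)"
  define y where "y = q ^ Suc n"
  have "1 - 2 * (\<Sum>A\<in>min_sets_upto (res_class 1 2) (Suc n). set_term q A) =
      (1 - y) * (1 - 2 * Z) + (-1) ^ Suc n * y"
    using sgn[of y] unfolding sum_set_term_Suc Z_def[symmetric] y_def[symmetric]
    by (simp add: algebra_simps)
  also have "1 - 2 * Z = qprod (-1) q n * euler_sum q n (- q)"
    unfolding Z_def by (rule Suc.IH)
  also have "(1 - y) * (qprod (-1) q n * euler_sum q n (- q)) + (-1) ^ Suc n * y =
      qprod (-1) q (Suc n) * (euler_sum q n (- q) + (- q) ^ Suc n / qprod (-1) q (Suc n))"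
  proof -
    have e1: "qprod (-1) q (Suc n) * ((- q) ^ Suc n / qprod (-1) q (Suc n)) = (-1) ^ Suc n * y"
      using qprod_nonzero[OF q, of "-1" "Suc n"] by (simp add: y_def power_minus[of q])
    have e2: "qprod (-1) q (Suc n) = qprod (-1) q n * (1 - y)"
      by (simp add: qprod_Suc y_def)
    show ?thesis
      unfolding distrib_left e1 unfolding e2 by (simp only: mult_ac)
  qed
  also have "euler_sum q n (- q) + (- q) ^ Suc n / qprod (-1) q (Suc n) = euler_sum q (Suc n) (- q)"
    by (simp add: euler_sum_def)
  finally show ?case .
qed (simp add: min_sets_upto_0 euler_sum_def)

text \<open>The classes together contain every positive integer, so one minus the sum is simply
  multiplied by \<open>1 - q ^ Suc n\<close>.\<close>

lemma sum_set_term_odd_even: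
  "(\<Sum>A\<in>min_sets_upto (res_class 1 2) n. set_term q A) +
   (\<Sum>A\<in>min_sets_upto (res_class 2 2) n. set_term q A) = 1 - qprod (-1) q n"
proof (induction n)
  case (Suc n)
  have "(if Suc n \<in> res_class 1 2 then y else 0) + (if Suc n \<in> res_class 2 2 then y else 0) = y" for y :: complex
    by (auto simp: mem_res_class_1_2 mem_res_class_2_2 simp del: One_nat_def)
  moreover have "(1 - y) * a + c + ((1 - y) * b + d) = (1 - y) * (a + b) + (c + d)" for y a b c d :: complex
    by (simp add: algebra_simps)
  ultimately show ?case
    unfolding sum_set_term_Suc by (simp only: Suc.IH) (simp add: qprod_Suc algebra_simps)
qed (simp add: min_sets_upto_0)

subsection \<open>Alternating sums with quadratic exponents in Stolz regions\<close>

definition alt_sum :: "(nat \<Rightarrow> nat) \<Rightarrow> complex \<Rightarrow> complex" where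
  "alt_sum g q = (\<Sum>n. (-1) ^ n * q ^ g n)"

lemma summable_alt_power:
  fixes q :: complex
  assumes "cmod q < 1" "\<And>n. n \<le> g n"
  shows "summable (\<lambda>n. (-1) ^ n * q ^ g n)"
proof (rule summable_comparison_test')
  show "summable (\<lambda>n. cmod q ^ n)"
    using assms by (intro summable_geometric) auto
  show "norm ((-1) ^ n * q ^ g n) \<le> cmod q ^ n" if "n \<ge> 0" for n
    using assms power_decreasing[of n "g n" "cmod q"] by (simp add: norm_mult norm_power)
qed

text \<open>With \<open>a n\<close> the signed term, the right-hand series is that of
  \<open>a n + 2 * a (Suc n) + a (Suc (Suc n))\<close>: four copies of the sum, short of
  \<open>3 * a 0 + a 1\<close>.\<close>

lemma alt_sum_second_difference:
  fixes q :: complex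
  assumes q: "cmod q < 1" and g: "\<And>n. n \<le> g n"
  shows "4 * alt_sum g q = 3 * q ^ g 0 - q ^ g 1 +
    (\<Sum>n. (-1) ^ n * (q ^ g n - 2 * q ^ g (Suc n) + q ^ g (Suc (Suc n))))"
proof -
  define a where "a = (\<lambda>n. (-1) ^ n * q ^ g n)"
  have a: "summable a"
    unfolding a_def by (rule summable_alt_power[OF q g])
  hence a1: "summable (\<lambda>n. a (Suc n))" and a2: "summable (\<lambda>n. a (Suc (Suc n)))"
    by (simp_all only: summable_Suc_iff[of a] summable_Suc_iff[of "\<lambda>n. a (Suc n)"])
  have "(\<Sum>n. (-1) ^ n * (q ^ g n - 2 * q ^ g (Suc n) + q ^ g (Suc (Suc n)))) =
      (\<Sum>n. a n + 2 * a (Suc n) + a (Suc (Suc n)))"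
    by (rule suminf_cong) (simp add: a_def algebra_simps)
  also have "\<dots> = suminf a + 2 * (\<Sum>n. a (Suc n)) + (\<Sum>n. a (Suc (Suc n)))"
    using a a1 a2 by (simp add: suminf_add[symmetric] summable_add summable_mult suminf_mult)
  also have "(\<Sum>n. a (Suc (Suc n))) = (\<Sum>n. a (Suc n)) - a 1"
    using suminf_split_head[OF a1] by simp
  also have "(\<Sum>n. a (Suc n)) = suminf a - a 0"
    by (rule suminf_split_head[OF a])
  finally show ?thesis
    by (simp add: alt_sum_def a_def[symmetric]) (simp add: a_def)
qed

lemma one_minus_power_le:
  fixes q :: complex
  assumes "cmod q \<le> 1"
  shows "cmod (1 - q ^ m) \<le> of_nat m * cmod (1 - q)"
  using norm_power_diff[of 1 q m] assms by simp

lemma exp_minus_bounds: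
  fixes x :: real
  assumes "x \<ge> 0"
  shows "exp (- x) * x \<le> 1" "exp (- x) * x\<^sup>2 \<le> 2"
proof -
  have *: "1 + x + x\<^sup>2 / 2 \<le> exp x"
    using exp_lower_Taylor_quadratic[OF assms] .
  have "x \<le> exp x" "x\<^sup>2 \<le> 2 * exp x"
    using * assms zero_le_power2[of x] by linarith+
  thus "exp (- x) * x \<le> 1" "exp (- x) * x\<^sup>2 \<le> 2"
    by (simp_all add: exp_minus field_simps)
qed

text \<open>The exponent is a sum over an arithmetic progression, so its second difference is the
  constant \<open>d\<close>; this covers squares and both kinds of pentagonal numbers. The series of
  second differences tends to 0, and the boundary terms give \<open>(3 - 1) / 4\<close>.\<close>

lemma alt_sum_quadratic_tendsto_half:
  fixes d e :: nat
  assumes d: "d \<ge> 1" and e: "e \<ge> 1" and M: "M \<ge> 1"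
  shows "(alt_sum (\<lambda>n. \<Sum>k<n. d * k + e) \<longlongrightarrow> 1/2) (at 1 within stolz_region M)"
proof (cases "at (1::complex) within stolz_region M = bot")
  case False
  define F where "F = at (1::complex) within stolz_region M"
  define g where "g = (\<lambda>n. \<Sum>k<n. d * k + e)"
  define b where "b = (\<lambda>n q. (-1) ^ n * (q ^ g n - 2 * q ^ g (Suc n) + q ^ g (Suc (Suc n))) :: complex)"
  define K where "K = 8 * ((d + e) * M)\<^sup>2 + 2 * d * M"
  have g_Suc: "g (Suc n) = g n + (d * n + e)" for n
    by (simp add: g_def)
  \<comment> \<open>Quadratic growth of the exponent provides the decay \<open>exp (- x)\<close>
    below.\<close>
  have g_ge: "n\<^sup>2 \<le> 2 * g n" for n
  proof (induction n)
    case (Suc n)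
    have "n \<le> d * n" using d by simp
    hence "n + 1 \<le> d * n + e"
      using e by (rule add_mono)
    hence "(Suc n)\<^sup>2 \<le> n\<^sup>2 + 2 * (d * n + e)"
      unfolding power2_eq_square by simp
    thus ?case using Suc by (simp add: g_Suc)
  qed (simp add: g_def)
  have g_le: "n \<le> g n" for n
    by (induction n) (use e in \<open>auto simp: g_Suc\<close>)
  have in_region: "eventually (\<lambda>q. q \<in> stolz_region M) F"
    by (simp add: F_def eventually_at_filter)
  have bound: "cmod (b n q) \<le> K * inverse (real n ^ 2)" if n: "n \<ge> 1" and q: "q \<in> stolz_region M" for n q
  proof -
    \<comment> \<open>In terms of \<open>x\<close>, a factor \<open>\<delta>\<close> is
      \<open>2 * x / n\<^sup>2\<close> and \<open>(\<delta> * n)\<^sup>2\<close> is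
      \<open>4 * x\<^sup>2 / n\<^sup>2\<close>; the powers of \<open>x\<close> are then absorbed by
      \<open>exp (- x)\<close>, which leaves the constant \<open>K\<close>.\<close>
    define r \<delta> x where "r = cmod q" and "\<delta> = 1 - r" and "x = \<delta> * real n ^ 2 / 2"
    define m where "m = d * n + e"
    have r: "0 \<le> r" "r < 1" and \<delta>: "\<delta> > 0" and qM: "cmod (1 - q) \<le> M * \<delta>"
      using q by (auto simp: stolz_region_def r_def \<delta>_def)
    have x: "x \<ge> 0" using \<delta> by (simp add: x_def)
    have m_le: "real m \<le> real (d + e) * real n"
    proof -
      have "m \<le> (d + e) * n" using n by (simp add: m_def algebra_simps)
      thus ?thesis by (simp only: of_nat_mult[symmetric] of_nat_le_iff)
    qed
    have pow: "r ^ g n \<le> exp (- x)"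
    proof -
      have "r \<le> exp (- \<delta>)"
        using exp_ge_add_one_self[of "- \<delta>"] by (simp add: \<delta>_def)
      hence "r ^ g n \<le> exp (- \<delta>) ^ g n"
        using r by (intro power_mono) auto
      also have "\<dots> = exp (- (\<delta> * real (g n)))"
        by (simp add: exp_of_nat_mult[symmetric] mult.commute)
      also have "\<dots> \<le> exp (- x)"
      proof -
        have "real n ^ 2 \<le> 2 * real (g n)"
          using g_ge[of n] by (metis of_nat_le_iff of_nat_mult of_nat_numeral of_nat_power)
        thus ?thesis using \<delta> by (simp add: x_def)
      qed
      finally show ?thesis .
    qed
    have g_Suc2: "g (Suc n) = g n + m" "g (Suc (Suc n)) = g n + (m + (m + d))"
      by (simp_all add: g_Suc m_def)
    \<comment> \<open>The second difference splits into a square of size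
      \<open>(n * \<delta>)\<^sup>2\<close> and a term of size \<open>\<delta>\<close>, by the Stolz
      condition.\<close>
    have "b n q = (-1) ^ n * (q ^ g n * ((1 - q ^ m)\<^sup>2 - q ^ (2 * m) * (1 - q ^ d)))"
      unfolding b_def g_Suc2 mult_2 power_add power2_eq_square by (simp add: algebra_simps)
    hence "cmod (b n q) = r ^ g n * cmod ((1 - q ^ m)\<^sup>2 - q ^ (2 * m) * (1 - q ^ d))"
      by (simp add: norm_mult norm_power r_def)
    also have "cmod ((1 - q ^ m)\<^sup>2 - q ^ (2 * m) * (1 - q ^ d)) \<le>
        cmod (1 - q ^ m) ^ 2 + r ^ (2 * m) * cmod (1 - q ^ d)"
      by (rule order.trans[OF norm_triangle_ineq4]) (simp add: norm_mult norm_power r_def)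
    also have "\<dots> \<le> (real m * (M * \<delta>))\<^sup>2 + 1 * (real d * (M * \<delta>))"
    proof (intro add_mono power_mono mult_mono)
      have *: "cmod (1 - q ^ k) \<le> real k * (M * \<delta>)" for k
        using one_minus_power_le[of q k] r qM mult_left_mono[OF qM, of "real k"] by (simp add: r_def)
      show "cmod (1 - q ^ m) \<le> real m * (M * \<delta>)" "cmod (1 - q ^ d) \<le> real d * (M * \<delta>)"
        by (rule *)+
      show "r ^ (2 * m) \<le> 1" using r by (intro power_le_one) auto
    qed auto
    also have "\<dots> \<le> (real (d + e) * real n * (M * \<delta>))\<^sup>2 + real d * (M * \<delta>)"
      using m_le M \<delta> by (intro add_mono power_mono mult_right_mono) auto
    also have "\<dots> = (4 * ((d + e) * M)\<^sup>2 * x\<^sup>2 + 2 * d * M * x) * inverse (real n ^ 2)"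
      using n by (simp add: x_def field_simps power2_eq_square)
    finally have "cmod (b n q) \<le>
        r ^ g n * ((4 * ((d + e) * M)\<^sup>2 * x\<^sup>2 + 2 * d * M * x) * inverse (real n ^ 2))"
      using r by (simp add: mult_left_mono)
    also have "\<dots> \<le> exp (- x) * ((4 * ((d + e) * M)\<^sup>2 * x\<^sup>2 + 2 * d * M * x) * inverse (real n ^ 2))"
      using x M by (intro mult_right_mono pow) auto
    also have "\<dots> = (4 * ((d + e) * M)\<^sup>2 * (exp (- x) * x\<^sup>2) + 2 * d * M * (exp (- x) * x)) * inverse (real n ^ 2)"
      by (simp add: algebra_simps)
    also have "\<dots> \<le> (4 * ((d + e) * M)\<^sup>2 * 2 + 2 * d * M * 1) * inverse (real n ^ 2)"
      using M by (intro mult_right_mono add_mono mult_left_mono exp_minus_bounds x) auto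
    finally show ?thesis by (simp add: K_def)
  qed
  have "((\<lambda>q. \<Sum>n. b n q) \<longlongrightarrow> (\<Sum>n. (0 :: complex))) F"
  proof -
    have "(b n \<longlongrightarrow> b n 1) F" for n
      unfolding b_def F_def by (intro tendsto_intros)
    hence lim: "((\<lambda>q. b n q) \<longlongrightarrow> 0) F" for n
      by (simp add: b_def)
    \<comment> \<open>The index 0 is excluded because \<open>inverse 0 = 0\<close> would make the
      dominating term vanish there.\<close>
    have "eventually (\<lambda>(n, q). cmod (b n q) \<le> K * inverse (real n ^ 2)) (at_top \<times>\<^sub>F F)"
      using eventually_prodI[OF eventually_ge_at_top[of "1::nat"] in_region]
      by eventually_elim (use bound in auto)
    moreover have "summable (\<lambda>n. K * inverse (real n ^ 2))"
      by (intro summable_mult inverse_power_summable) auto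
    ultimately show ?thesis
      using tannerys_theorem[of b "\<lambda>_. 0" F, OF lim] False by (auto simp: F_def)
  qed
  hence "((\<lambda>q. (3 * q ^ g 0 - q ^ g 1 + (\<Sum>n. b n q)) / 4) \<longlongrightarrow> (3 * 1 ^ g 0 - 1 ^ g 1 + 0) / 4) F"
    by (intro tendsto_intros) (auto simp: F_def)
  moreover have "eventually (\<lambda>q. alt_sum g q = (3 * q ^ g 0 - q ^ g 1 + (\<Sum>n. b n q)) / 4) F"
    using in_region
  proof eventually_elim
    case (elim q)
    hence "cmod q < 1" by (simp add: stolz_region_def)
    from alt_sum_second_difference[OF this g_le] show ?case
      by (simp add: b_def mult.commute)
  qed
  ultimately have "(alt_sum g \<longlongrightarrow> (3 * 1 ^ g 0 - 1 ^ g 1 + 0) / 4) F"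
    by (subst tendsto_cong)
  thus ?thesis
    by (simp add: g_def F_def)
qed auto

subsection \<open>The two generating functions\<close>

lemma sum_symmetric_int_interval:
  fixes f :: "int \<Rightarrow> 'a::comm_monoid_add"
  shows "(\<Sum>m\<in>{- int n..int n}. f m) = f 0 + (\<Sum>k=1..n. f (int k) + f (- int k))"
proof (induction n)
  case (Suc n)
  have "{- int (Suc n)..int (Suc n)} = insert (int (Suc n)) (insert (- int (Suc n)) {- int n..int n})"
    by auto
  thus ?case
    using Suc by (simp add: add_ac)
qed simp

lemma finite_int_subset_symmetric_interval:
  assumes "finite (X :: int set)"
  obtains n where "X \<subseteq> {- int n..int n}"
proof
  have "nat \<bar>m\<bar> \<le> Max (insert 0 ((\<lambda>m. nat \<bar>m\<bar>) ` X))" if "m \<in> X" for m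
    using assms that by (intro Max_ge) auto
  thus "X \<subseteq> {- int (Max (insert 0 ((\<lambda>m. nat \<bar>m\<bar>) ` X)))..int (Max (insert 0 ((\<lambda>m. nat \<bar>m\<bar>) ` X)))}"
    by (force simp: nat_le_iff)
qed

text \<open>For every integer \<open>m\<close> the number \<open>m * (3 * m - 1)\<close> is even and
  nonnegative, so \<open>div\<close> and \<open>nat\<close> lose nothing.\<close>

definition penta_int_term :: "complex \<Rightarrow> int \<Rightarrow> complex" where
  "penta_int_term q m = (-1) powi m * q ^ nat (m * (3 * m - 1) div 2)"

lemma penta_int_term_pos:
  "penta_int_term q (int k) = (-1) ^ k * q ^ (k * (3 * k - 1) div 2)"
proof -
  have "int k * (3 * int k - 1) = int (k * (3 * k - 1))"
    by (cases k) (simp_all add: algebra_simps)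
  hence "nat (int k * (3 * int k - 1) div 2) = k * (3 * k - 1) div 2"
    by (metis nat_int of_nat_numeral zdiv_int)
  thus ?thesis
    by (simp add: penta_int_term_def)
qed

lemma penta_int_term_neg:
  "penta_int_term q (- int k) = (-1) ^ k * q ^ (k * (3 * k + 1) div 2)"
proof -
  have "(- int k) * (3 * (- int k) - 1) = int (k * (3 * k + 1))"
    by (simp add: algebra_simps)
  hence "nat ((- int k) * (3 * (- int k) - 1) div 2) = k * (3 * k + 1) div 2"
    by (metis nat_int of_nat_numeral zdiv_int)
  moreover have "(-1 :: complex) powi (- int k) = (-1) ^ k"
    by (cases "even k") (simp_all add: power_int_minus)
  ultimately show ?thesis
    by (simp add: penta_int_term_def)
qed

lemma penta_exponent_ge:
  fixes k :: nat
  shows "k \<le> k * (3 * k - 1) div 2" "k \<le> k * (3 * k + 1) div 2"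
proof -
  have "k * 2 \<le> k * (3 * k - 1)" "k * 2 \<le> k * (3 * k + 1)"
    by (cases k; simp)+
  thus "k \<le> k * (3 * k - 1) div 2" "k \<le> k * (3 * k + 1) div 2"
    by (simp_all add: less_eq_div_iff_mult_less_eq)
qed

text \<open>Both exponents at distance \<open>k\<close> from 0 are at least \<open>k\<close>, so
  twice a geometric series dominates.\<close>

lemma penta_int_term_summable_on:
  assumes q: "cmod q < 1"
  shows "penta_int_term q summable_on UNIV"
proof -
  have "(\<Sum>m\<in>X. norm (penta_int_term q m)) \<le> 1 + 2 * (cmod q / (1 - cmod q))"
    if X: "finite X" for X
  proof -
    obtain n where n: "X \<subseteq> {- int n..int n}"
      using finite_int_subset_symmetric_interval[OF X] .
    have "(\<Sum>m\<in>X. norm (penta_int_term q m)) \<le> (\<Sum>m\<in>{- int n..int n}. norm (penta_int_term q m))"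
      using n by (intro sum_mono2) auto
    also have "\<dots> = 1 + (\<Sum>k=1..n. norm (penta_int_term q (int k)) + norm (penta_int_term q (- int k)))"
      unfolding sum_symmetric_int_interval by (simp add: penta_int_term_def)
    also have "\<dots> \<le> 1 + (\<Sum>k=1..n. cmod q ^ k + cmod q ^ k)"
      unfolding penta_int_term_pos penta_int_term_neg
      using q penta_exponent_ge
      by (intro add_left_mono sum_mono add_mono) (auto simp: norm_mult norm_power intro!: power_decreasing)
    also have "\<dots> = 1 + 2 * (\<Sum>k=1..n. cmod q ^ k)"
      by (simp add: sum_distrib_left)
    also have "\<dots> \<le> 1 + 2 * (cmod q / (1 - cmod q))"
      using sum_power_le[of "cmod q" n] q by simp
    finally show ?thesis .
  qed
  hence "(\<lambda>m. norm (penta_int_term q m)) summable_on UNIV"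
    unfolding abs_summable_iff_bdd_above by (intro bdd_aboveI2) auto
  thus ?thesis
    by (rule abs_summable_summable)
qed

lemma penta_partial_sum_tendsto:
  assumes q: "cmod q < 1"
  shows "(\<lambda>n. 1 + (\<Sum>k=1..n. (-1) ^ k * (q ^ (k * (3 * k - 1) div 2) + q ^ (k * (3 * k + 1) div 2))))
    \<longlonglongrightarrow> (\<Sum>\<^sub>\<infinity>m. penta_int_term q m)"
proof -
  have "(\<lambda>n. \<Sum>m\<in>{- int n..int n}. penta_int_term q m) \<longlonglongrightarrow> (\<Sum>\<^sub>\<infinity>m. penta_int_term q m)"
  proof (rule has_sum_imp_exhaustion_tendsto)
    show "(penta_int_term q has_sum (\<Sum>\<^sub>\<infinity>m. penta_int_term q m)) UNIV"
      by (rule has_sum_infsum[OF penta_int_term_summable_on[OF q]])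
    show "eventually (\<lambda>n. X \<subseteq> {- int n..int n}) sequentially" if X: "finite X" for X
    proof -
      obtain n where n: "X \<subseteq> {- int n..int n}"
        using finite_int_subset_symmetric_interval[OF X] .
      show ?thesis
        using eventually_ge_at_top[of n] by eventually_elim (use n in force)
    qed
  qed auto
  moreover have "penta_int_term q 0 = 1"
    by (simp add: penta_int_term_def)
  ultimately show ?thesis
    unfolding sum_symmetric_int_interval penta_int_term_pos penta_int_term_neg
    by (simp add: distrib_left)
qed

lemma alt_partial_sum_tendsto:
  assumes "cmod q < 1" "\<And>n. n \<le> g n" "g 0 = 0"
  shows "(\<lambda>n. \<Sum>k=1..n. (-1) ^ k * q ^ g k) \<longlonglongrightarrow> alt_sum g q - 1"
proof -
  have "(\<lambda>n. \<Sum>k\<le>n. (-1) ^ k * q ^ g k) \<longlonglongrightarrow> alt_sum g q"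
    unfolding alt_sum_def using summable_alt_power[OF assms(1,2)] by (rule summable_LIMSEQ')
  hence "(\<lambda>n. (\<Sum>k\<le>n. (-1) ^ k * q ^ g k) - 1) \<longlonglongrightarrow> alt_sum g q - 1"
    by (intro tendsto_intros)
  moreover have "(\<Sum>k\<le>n. (-1) ^ k * q ^ g k) - 1 = (\<Sum>k=1..n. (-1) ^ k * q ^ g k)" for n
    unfolding atMost_atLeast0 by (subst sum.atLeast_Suc_atMost) (auto simp: assms(3))
  ultimately show ?thesis by simp
qed

text \<open>Each one-sided series has its own constant term 1, while the bilateral one has a single
  such term; hence the correction by 1. This form makes the limit at 1 accessible.\<close>

lemma infsum_penta_int_term:
  assumes q: "cmod q < 1"
  shows "(\<Sum>\<^sub>\<infinity>m. penta_int_term q m) =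
    alt_sum (\<lambda>k. k * (3 * k - 1) div 2) q + alt_sum (\<lambda>k. k * (3 * k + 1) div 2) q - 1"
proof -
  have "(\<lambda>n. 1 + ((\<Sum>k=1..n. (-1) ^ k * q ^ (k * (3 * k - 1) div 2)) +
      (\<Sum>k=1..n. (-1) ^ k * q ^ (k * (3 * k + 1) div 2)))) \<longlonglongrightarrow>
      1 + ((alt_sum (\<lambda>k. k * (3 * k - 1) div 2) q - 1) + (alt_sum (\<lambda>k. k * (3 * k + 1) div 2) q - 1))"
    by (intro tendsto_add tendsto_const alt_partial_sum_tendsto q penta_exponent_ge) auto
  moreover have "(\<lambda>n. 1 + ((\<Sum>k=1..n. (-1) ^ k * q ^ (k * (3 * k - 1) div 2)) +
      (\<Sum>k=1..n. (-1) ^ k * q ^ (k * (3 * k + 1) div 2)))) \<longlonglongrightarrow> (\<Sum>\<^sub>\<infinity>m. penta_int_term q m)"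
    using penta_partial_sum_tendsto[OF q] by (simp add: distrib_left sum.distrib)
  ultimately have "(\<Sum>\<^sub>\<infinity>m. penta_int_term q m) =
      1 + ((alt_sum (\<lambda>k. k * (3 * k - 1) div 2) q - 1) + (alt_sum (\<lambda>k. k * (3 * k + 1) div 2) q - 1))"
    by (rule LIMSEQ_unique[rotated])
  thus ?thesis by simp
qed

lemma qprod_tendsto_penta_sum:
  assumes q: "cmod q < 1"
  shows "qprod (-1) q \<longlonglongrightarrow> (\<Sum>\<^sub>\<infinity>m. penta_int_term q m)"
  using tendsto_add[OF qprod_penta_diff_tendsto_0[OF q] penta_partial_sum_tendsto[OF q]] by simp

section \<open>Closed forms of the two generating functions\<close>

lemma le_power2: "n \<le> n\<^sup>2" for n :: nat
  by (simp add: power2_eq_square)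

text \<open>The two vanishing differences link \<open>P\<^sub>n\<close> times Euler's sum to the
  quotient and the quotient to the theta partial sums, so \<open>1 - 2 * F\<close> equals the theta
  series.\<close>

lemma F_part_odd:
  assumes q: "cmod q < 1"
  shows "F_part (res_class 1 2) q = 1 - alt_sum (\<lambda>k. k\<^sup>2) q"
proof -
  have theta: "(\<lambda>n. 1 + 2 * (\<Sum>k=1..n. (-1) ^ k * q ^ k\<^sup>2)) \<longlonglongrightarrow> 1 + 2 * (alt_sum (\<lambda>k. k\<^sup>2) q - 1)"
    by (intro tendsto_intros alt_partial_sum_tendsto[OF q le_power2]) auto
  have "(\<lambda>n. qprod (-1) q n * euler_sum q n (- q)) \<longlonglongrightarrow> 1 + 2 * (alt_sum (\<lambda>k. k\<^sup>2) q - 1)"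
    using tendsto_add[OF euler_sum_gauss_quot_diff_tendsto_0[OF q]
        tendsto_add[OF gauss_quot_theta_diff_tendsto_0[OF q] theta]] by simp
  moreover have "(\<lambda>n. qprod (-1) q n * euler_sum q n (- q)) \<longlonglongrightarrow> 1 - 2 * F_part (res_class 1 2) q"
    unfolding sum_set_term_odd[OF q, symmetric]
    by (intro tendsto_intros sum_set_term_tendsto_F_part[OF q])
  ultimately have "1 - 2 * F_part (res_class 1 2) q = 1 + 2 * (alt_sum (\<lambda>k. k\<^sup>2) q - 1)"
    by (rule LIMSEQ_unique[rotated])
  hence "2 * F_part (res_class 1 2) q = 2 * (1 - alt_sum (\<lambda>k. k\<^sup>2) q)"
    by (simp add: algebra_simps)
  thus ?thesis
    by (simp only: mult_cancel_left) simp
qed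

lemma F_part_even:
  assumes q: "cmod q < 1"
  shows "F_part (res_class 2 2) q = alt_sum (\<lambda>k. k\<^sup>2) q - (\<Sum>\<^sub>\<infinity>m. penta_int_term q m)"
proof -
  have "(\<lambda>n. 1 - qprod (-1) q n) \<longlonglongrightarrow> F_part (res_class 1 2) q + F_part (res_class 2 2) q"
    unfolding sum_set_term_odd_even[symmetric]
    by (intro tendsto_intros sum_set_term_tendsto_F_part[OF q])
  moreover have "(\<lambda>n. 1 - qprod (-1) q n) \<longlonglongrightarrow> 1 - (\<Sum>\<^sub>\<infinity>m. penta_int_term q m)"
    by (intro tendsto_intros qprod_tendsto_penta_sum[OF q])
  ultimately have "F_part (res_class 1 2) q + F_part (res_class 2 2) q = 1 - (\<Sum>\<^sub>\<infinity>m. penta_int_term q m)"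
    by (rule LIMSEQ_unique)
  thus ?thesis
    unfolding F_part_odd[OF q] by (simp add: algebra_simps)
qed

section \<open>Exponents as sums over arithmetic progressions, and the limits at 1\<close>

lemma square_eq_sum: "(\<lambda>k. k\<^sup>2) = (\<lambda>n::nat. \<Sum>k<n. 2 * k + 1)"
proof
  show "n\<^sup>2 = (\<Sum>k<n. 2 * k + 1)" for n :: nat
    by (induction n) (auto simp: power2_eq_square)
qed

lemma pentagonal_eq_sum: "(\<lambda>k. k * (3 * k - 1) div 2) = (\<lambda>n::nat. \<Sum>k<n. 3 * k + 1)"
proof
  fix n :: nat
  have "n * (3 * n - 1) = 2 * (\<Sum>k<n. 3 * k + 1)"
  proof (induction n)
    case (Suc n)
    have "Suc n * (3 * Suc n - 1) = n * (3 * n - 1) + 2 * (3 * n + 1)"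
      by (cases n) (simp_all add: algebra_simps)
    thus ?case using Suc by simp
  qed simp
  thus "n * (3 * n - 1) div 2 = (\<Sum>k<n. 3 * k + 1)" by simp
qed

lemma second_pentagonal_eq_sum: "(\<lambda>k. k * (3 * k + 1) div 2) = (\<lambda>n::nat. \<Sum>k<n. 3 * k + 2)"
proof
  fix n :: nat
  have "n * (3 * n + 1) = 2 * (\<Sum>k<n. 3 * k + 2)"
    by (induction n) (auto simp: algebra_simps)
  thus "n * (3 * n + 1) div 2 = (\<Sum>k<n. 3 * k + 2)" by simp
qed

lemma sums_alt_squares:
  assumes q: "cmod q < 1"
  shows "(\<lambda>n. (-1) ^ Suc n * q ^ (Suc n)\<^sup>2) sums (alt_sum (\<lambda>k. k\<^sup>2) q - 1)"
  using summable_alt_power[OF q le_power2] sums_Suc_iff[of "\<lambda>n. (-1) ^ n * q ^ n\<^sup>2"]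
  by (simp add: alt_sum_def summable_sums)

text \<open>All three alternating sums tend to 1/2, so the bilateral pentagonal series tends to
  \<open>1/2 + 1/2 - 1 = 0\<close> and does not affect the even case.\<close>

lemma F_part_tendsto_half:
  assumes M: "M \<ge> 1"
  shows "(F_part (res_class 1 2) \<longlongrightarrow> 1/2) (at 1 within stolz_region M)"
    and "(F_part (res_class 2 2) \<longlongrightarrow> 1/2) (at 1 within stolz_region M)"
proof -
  let ?F = "at (1::complex) within stolz_region M"
  have in_disk: "eventually (\<lambda>q. cmod q < 1) ?F"
    by (simp add: eventually_at_filter stolz_region_def)
  have A: "(alt_sum (\<lambda>k. k\<^sup>2) \<longlongrightarrow> 1/2) ?F"
    "(alt_sum (\<lambda>k. k * (3 * k - 1) div 2) \<longlongrightarrow> 1/2) ?F"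
    "(alt_sum (\<lambda>k. k * (3 * k + 1) div 2) \<longlongrightarrow> 1/2) ?F"
    unfolding square_eq_sum pentagonal_eq_sum second_pentagonal_eq_sum
    by (intro alt_sum_quadratic_tendsto_half M; simp)+
  have "eventually (\<lambda>q. F_part (res_class 1 2) q = 1 - alt_sum (\<lambda>k. k\<^sup>2) q) ?F"
    using in_disk by eventually_elim (rule F_part_odd)
  moreover have "((\<lambda>q. 1 - alt_sum (\<lambda>k. k\<^sup>2) q) \<longlongrightarrow> 1 - 1/2) ?F"
    by (intro tendsto_intros A)
  ultimately show "(F_part (res_class 1 2) \<longlongrightarrow> 1/2) ?F"
    by (subst tendsto_cong) auto
  have "eventually (\<lambda>q. F_part (res_class 2 2) q = alt_sum (\<lambda>k. k\<^sup>2) q -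
      (alt_sum (\<lambda>k. k * (3 * k - 1) div 2) q + alt_sum (\<lambda>k. k * (3 * k + 1) div 2) q - 1)) ?F"
    using in_disk by eventually_elim (simp only: F_part_even infsum_penta_int_term)
  moreover have "((\<lambda>q. alt_sum (\<lambda>k. k\<^sup>2) q - (alt_sum (\<lambda>k. k * (3 * k - 1) div 2) q +
      alt_sum (\<lambda>k. k * (3 * k + 1) div 2) q - 1)) \<longlongrightarrow> 1/2 - (1/2 + 1/2 - 1)) ?F"
    by (intro tendsto_intros A)
  ultimately show "(F_part (res_class 2 2) \<longlongrightarrow> 1/2) ?F"
    by (subst tendsto_cong) auto
qed

theorem theorem6p1:
  "(\<forall>q::complex. cmod q < 1 \<longrightarrow>
      F_term q summable_on partitions_sm (res_class 1 2) \<and>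
      F_term q summable_on partitions_sm (res_class 2 2) \<and>
      summable (\<lambda>n::nat. (-1) ^ (Suc n + 1) * q ^ ((Suc n)\<^sup>2)) \<and>
      summable (\<lambda>n::nat. (-1) ^ Suc n * q ^ ((Suc n)\<^sup>2)) \<and>
      (\<lambda>m::int. (-1) powi m * q ^ nat (m * (3 * m - 1) div 2)) summable_on UNIV \<and>
      F_part (res_class 1 2) q = (\<Sum>n::nat. (-1) ^ (Suc n + 1) * q ^ ((Suc n)\<^sup>2)) \<and>
      F_part (res_class 2 2) q =
        1 + (\<Sum>n::nat. (-1) ^ Suc n * q ^ ((Suc n)\<^sup>2))
          - (\<Sum>\<^sub>\<infinity>m\<in>(UNIV::int set). (-1) powi m * q ^ nat (m * (3 * m - 1) div 2))) \<and>
   (\<forall>M\<ge>1.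
      (F_part (res_class 1 2) \<longlongrightarrow> 1/2) (at 1 within stolz_region M) \<and>
      (F_part (res_class 2 2) \<longlongrightarrow> 1/2) (at 1 within stolz_region M))"
proof (intro conjI allI impI)
  fix q :: complex assume q: "cmod q < 1"
  note sq = sums_alt_squares[OF q]
  have sq': "(\<lambda>n. (-1) ^ (Suc n + 1) * q ^ ((Suc n)\<^sup>2)) sums (1 - alt_sum (\<lambda>k. k\<^sup>2) q)"
    using sums_minus[OF sq] by simp
  show "F_term q summable_on partitions_sm (res_class 1 2)"
    "F_term q summable_on partitions_sm (res_class 2 2)"
    by (rule F_term_summable_on[OF q])+
  show "summable (\<lambda>n::nat. (-1) ^ (Suc n + 1) * q ^ ((Suc n)\<^sup>2))"
    using sq' by (rule sums_summable)
  show "summable (\<lambda>n::nat. (-1) ^ Suc n * q ^ ((Suc n)\<^sup>2))"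
    using sq by (rule sums_summable)
  show "(\<lambda>m::int. (-1) powi m * q ^ nat (m * (3 * m - 1) div 2)) summable_on UNIV"
    using penta_int_term_summable_on[OF q] unfolding penta_int_term_def .
  show "F_part (res_class 1 2) q = (\<Sum>n::nat. (-1) ^ (Suc n + 1) * q ^ ((Suc n)\<^sup>2))"
    unfolding F_part_odd[OF q] by (rule sums_unique[OF sq'])
  show "F_part (res_class 2 2) q =
        1 + (\<Sum>n::nat. (-1) ^ Suc n * q ^ ((Suc n)\<^sup>2))
          - (\<Sum>\<^sub>\<infinity>m\<in>(UNIV::int set). (-1) powi m * q ^ nat (m * (3 * m - 1) div 2))"
    unfolding F_part_even[OF q] sums_unique[OF sq, symmetric] penta_int_term_def by simp
qed (fact F_part_tendsto_half)+

end
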